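(* Let $E=\mathrm{End}(\mathbb{Q},\le)$ be the monoid of all maps $f\colon\mathbb{Q}\to\mathbb{Q}$ such that $x\le y$ implies $f(x)\le f(y)$. Then $E$ has automatic homeomorphicity: for every countable set $\Omega$ and every closed submonoid $E'\subseteq\mathrm{Tr}(\Omega)$, every monoid isomorphism $\theta\colon E\to E'$ is a homeomorphism.
   Context: $\mathrm{Tr}(\Omega)$ is the monoid of all maps $\Omega\to\Omega$ under composition. It is topologized by taking as sub-basic open sets all sets $\{f\in \mathrm{Tr}(\Omega)\colon f(x)=y\}$ with $x,y\in\Omega$ (pointwise convergence, $\Omega$ discrete); submonoids carry the subspace topology. Likewise $E\subseteq \mathrm{Tr}(\mathbb{Q})$ carries the subspace topology. *)

theory Defs
  imports "HOL-Algebra.Group" "HOL-Analysis.Function_Topology"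
begin

text \<open>Maps \<open>\<Omega> \<rightarrow> \<Omega>\<close> on a set \<open>\<Omega>\<close> are represented extensionally
  (value \<open>undefined\<close> outside \<open>\<Omega>\<close>), so that equality of representatives is equality of maps.\<close>

definition Tr :: "'a set \<Rightarrow> ('a \<Rightarrow> 'a) monoid" where
  "Tr \<Omega> = \<lparr>carrier = \<Omega> \<rightarrow>\<^sub>E \<Omega>, mult = compose \<Omega>, one = (\<lambda>x\<in>\<Omega>. x)\<rparr>"

text \<open>The whole space is inserted because \<open>topology_generated_by\<close> does not form the
  empty intersection; this matters only for \<open>\<Omega> = {}\<close>.\<close>

definition Tr_topology :: "'a set \<Rightarrow> ('a \<Rightarrow> 'a) topology" where
  "Tr_topology \<Omega> = topology_generated_by
     (insert (\<Omega> \<rightarrow>\<^sub>E \<Omega>) {{f \<in> \<Omega> \<rightarrow>\<^sub>E \<Omega>. f x = y} |x y. x \<in> \<Omega> \<and> y \<in> \<Omega>})"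

definition End_rat :: "(rat \<Rightarrow> rat) set" where
  "End_rat = {f. \<forall>x y. x \<le> y \<longrightarrow> f x \<le> f y}"

lemma monoid_Tr: "monoid (Tr \<Omega>)"
  by (rule monoidI) (auto simp: Tr_def compose_def fun_eq_iff PiE_iff extensional_def)

lemma Tr_UNIV: "Tr (UNIV :: 'a set) = \<lparr>carrier = UNIV, mult = (\<circ>), one = id\<rparr>"
  by (auto simp: Tr_def compose_def fun_eq_iff)

lemma submonoid_End_rat: "submonoid End_rat (Tr UNIV)"
  by (rule submonoid.intro) (auto simp: Tr_UNIV End_rat_def)

lemma topspace_Tr_topology: "topspace (Tr_topology \<Omega>) = \<Omega> \<rightarrow>\<^sub>E \<Omega>"
  unfolding Tr_topology_def topology_generated_by_topspace by auto

lemma Tr_topology_eq_product_topology: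
  "Tr_topology \<Omega> = product_topology (\<lambda>_. discrete_topology \<Omega>) \<Omega>"
proof -
  let ?P = "product_topology (\<lambda>_. discrete_topology \<Omega>) \<Omega>"
  have top: "topspace ?P = \<Omega> \<rightarrow>\<^sub>E \<Omega>"
    by simp
  have proj: "continuous_map (Tr_topology \<Omega>) (discrete_topology \<Omega>) (\<lambda>f. f x)" if x: "x \<in> \<Omega>" for x
    unfolding continuous_map_def
  proof (intro conjI allI impI)
    show "(\<lambda>f. f x) \<in> topspace (Tr_topology \<Omega>) \<rightarrow> topspace (discrete_topology \<Omega>)"
      using x by (auto simp: topspace_Tr_topology)
    fix U assume "openin (discrete_topology \<Omega>) U"
    then have U: "U \<subseteq> \<Omega>" by simp
    have "{f \<in> topspace (Tr_topology \<Omega>). f x \<in> U} = (\<Union>y\<in>U. {f \<in> \<Omega> \<rightarrow>\<^sub>E \<Omega>. f x = y})"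
      by (auto simp: topspace_Tr_topology)
    moreover have "openin (Tr_topology \<Omega>) {f \<in> \<Omega> \<rightarrow>\<^sub>E \<Omega>. f x = y}" if "y \<in> U" for y
      unfolding Tr_topology_def
      by (rule topology_generated_by_Basis) (use x U that in blast)
    ultimately show "openin (Tr_topology \<Omega>) {f \<in> topspace (Tr_topology \<Omega>). f x \<in> U}"
      by auto
  qed
  have 1: "continuous_map (Tr_topology \<Omega>) ?P (\<lambda>f. f)"
    using proj by (auto simp: continuous_map_componentwise topspace_Tr_topology PiE_def)
  have 2: "continuous_map ?P (Tr_topology \<Omega>) (\<lambda>f. f)"
    unfolding Tr_topology_def
  proof (rule continuous_on_generated_topo)
    fix U
    assume "U \<in> insert (\<Omega> \<rightarrow>\<^sub>E \<Omega>) {{f \<in> \<Omega> \<rightarrow>\<^sub>E \<Omega>. f x = y} |x y. x \<in> \<Omega> \<and> y \<in> \<Omega>}"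
    then consider "U = \<Omega> \<rightarrow>\<^sub>E \<Omega>"
      | x y where "x \<in> \<Omega>" "y \<in> \<Omega>" "U = {f \<in> \<Omega> \<rightarrow>\<^sub>E \<Omega>. f x = y}"
      by blast
    then show "openin ?P ((\<lambda>f. f) -` U \<inter> topspace ?P)"
    proof cases
      case 1
      then have "(\<lambda>f. f) -` U \<inter> topspace ?P = topspace ?P"
        using top by auto
      then show ?thesis by (metis openin_topspace)
    next
      case (2 x y)
      have "continuous_map ?P (discrete_topology \<Omega>) (\<lambda>f. f x)"
        using 2(1) by (rule continuous_map_product_projection)
      then have "openin ?P {f \<in> topspace ?P. f x \<in> {y}}"
        by (rule openin_continuous_map_preimage) (use 2(2) in simp)
      moreover have "(\<lambda>f. f) -` U \<inter> topspace ?P = {f \<in> topspace ?P. f x \<in> {y}}"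
        using 2(3) top by auto
      ultimately show ?thesis by simp
    qed
  qed (use top in auto)
  have "openin (Tr_topology \<Omega>) U \<longleftrightarrow> openin ?P U" for U
  proof
    assume U: "openin (Tr_topology \<Omega>) U"
    have "{f \<in> topspace ?P. f \<in> U} = U"
      using openin_subset[OF U] unfolding top topspace_Tr_topology by blast
    then show "openin ?P U"
      using openin_continuous_map_preimage[OF 2 U] by simp
  next
    assume U: "openin ?P U"
    have "{f \<in> topspace (Tr_topology \<Omega>). f \<in> U} = U"
      using openin_subset[OF U] unfolding top topspace_Tr_topology by blast
    then show "openin (Tr_topology \<Omega>) U"
      using openin_continuous_map_preimage[OF 1 U] by simp
  qed
  then show ?thesis
    by (simp add: topology_eq)
qed

end

theory Submission
  imports Defs "HOL-Analysis.Urysohn"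
begin

text \<open>An isomorphism \<open>\<theta>\<close> makes \<open>E = End(\<rat>,\<le>)\<close> act on \<open>\<Omega>\<close>, and both continuity claims are local
statements about this action.

The inverse of \<open>\<theta>\<close> is continuous because \<open>\<rat>\<close> embeds equivariantly into \<open>\<Omega>\<close>. For a point \<open>w\<close>, the map
\<open>q \<mapsto> \<theta> (\<lambda>_. q) w\<close> is equivariant, and since \<open>E\<close> moves any pair \<open>a < b\<close> to any pair \<open>c < d\<close>, such a
map is injective as soon as it is not constant. Two different constants give a \<open>w\<close> for which it is not
constant (\<open>equivariant_embedding\<close>). Since \<open>E'\<close> is closed, it follows that the graph of \<open>\<theta>\<close> is closed
(\<open>closed_graph\<close>).

Continuity of \<open>\<theta>\<close> is obtained on larger and larger parts of \<open>E\<close>.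

On the automorphism group the argument is the one for the open mapping theorem. Automorphisms that act
alike on a finite \<open>W \<subseteq> \<Omega>\<close> fall into countably many classes, so by the Baire category theorem the
stabilizer of \<open>W\<close> is dense in some basic open subgroup (\<open>stabilizer_somewhere_dense\<close>). Successive
approximation, with the closed graph identifying the limit, removes the word ``dense''
(\<open>stabilizer_open\<close>).

On the order embeddings, which are pointwise limits of automorphisms, \<open>\<theta>\<close> has to agree with the
continuous extension from the automorphisms, again because its graph is closed
(\<open>\<theta>_local_on_embeddings\<close>).

An arbitrary \<open>f\<close> is written as \<open>p \<circ> t\<close> with one fixed \<open>p \<in> E\<close> and an order embedding \<open>t\<close> whose value at
\<open>x\<close> depends only on \<open>x\<close> and \<open>f x\<close> (\<open>End_rat_factor_through_embedding\<close>). Hence \<open>f\<close> and \<open>g\<close> that agree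
on a finite set have embeddings \<open>t\<close> that agree there, and continuity on the embeddings carries over to
\<open>E\<close> (\<open>\<theta>_local\<close>).\<close>

section \<open>The topology of pointwise convergence\<close>

lemma openin_agree_Tr:
  assumes "finite F"
  shows "openin (Tr_topology A) {f \<in> A \<rightarrow>\<^sub>E A. \<forall>a\<in>F \<inter> A. f a = g a}"
proof -
  have "{f \<in> A \<rightarrow>\<^sub>E A. \<forall>a\<in>F \<inter> A. f a = g a} = (\<Pi>\<^sub>E a\<in>A. if a \<in> F then {g a} \<inter> A else A)"
  proof (intro equalityI subsetI)
    fix f assume "f \<in> (\<Pi>\<^sub>E a\<in>A. if a \<in> F then {g a} \<inter> A else A)"
    then have *: "f a \<in> (if a \<in> F then {g a} \<inter> A else A)" "f \<in> extensional A" if "a \<in> A" for a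
      using that by (auto simp: PiE_iff)
    have "f a \<in> A" "a \<in> F \<Longrightarrow> f a = g a" if "a \<in> A" for a
      using *(1)[OF that] by (auto split: if_splits)
    moreover have "f \<in> extensional A"
      using \<open>f \<in> _\<close> by (simp add: PiE_iff)
    ultimately show "f \<in> {f \<in> A \<rightarrow>\<^sub>E A. \<forall>a\<in>F \<inter> A. f a = g a}"
      by (auto simp: PiE_iff)
  next
    fix f assume "f \<in> {f \<in> A \<rightarrow>\<^sub>E A. \<forall>a\<in>F \<inter> A. f a = g a}"
    then show "f \<in> (\<Pi>\<^sub>E a\<in>A. if a \<in> F then {g a} \<inter> A else A)"
      by (auto simp: PiE_iff Ball_def)
  qed
  moreover have "openin (product_topology (\<lambda>_. discrete_topology A) A)
      (\<Pi>\<^sub>E a\<in>A. if a \<in> F then {g a} \<inter> A else A)"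
  proof (rule product_topology_basis)
    show "finite {i. (if i \<in> F then {g i} \<inter> A else A) \<noteq> topspace (discrete_topology A)}"
      by (rule finite_subset[OF _ assms]) auto
  qed auto
  ultimately show ?thesis
    by (simp add: Tr_topology_eq_product_topology)
qed

lemma openin_subtopology_Tr_iff:
  assumes X: "X \<subseteq> A \<rightarrow>\<^sub>E A"
  shows "openin (subtopology (Tr_topology A) X) U \<longleftrightarrow>
    U \<subseteq> X \<and> (\<forall>f\<in>U. \<exists>F. finite F \<and> F \<subseteq> A \<and> (\<forall>g\<in>X. (\<forall>a\<in>F. g a = f a) \<longrightarrow> g \<in> U))"
    (is "?L \<longleftrightarrow> ?R")
proof
  assume ?L
  then obtain V where V: "openin (Tr_topology A) V" "U = V \<inter> X"
    by (auto simp: openin_subtopology)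
  have "\<exists>F. finite F \<and> F \<subseteq> A \<and> (\<forall>g\<in>X. (\<forall>a\<in>F. g a = f a) \<longrightarrow> g \<in> U)" if f: "f \<in> U" for f
  proof -
    obtain B where B: "f \<in> (\<Pi>\<^sub>E i\<in>A. B i)" "finite {i. B i \<noteq> A}" "(\<Pi>\<^sub>E i\<in>A. B i) \<subseteq> V"
      using product_topology_open_contains_basis[of "\<lambda>_. discrete_topology A" A V f] V f
      by (auto simp: Tr_topology_eq_product_topology)
    have "g \<in> U" if "g \<in> X" "\<forall>a\<in>{i. B i \<noteq> A} \<inter> A. g a = f a" for g
    proof -
      have g: "g \<in> A \<rightarrow>\<^sub>E A"
        using that X by auto
      have "g i \<in> B i" if "i \<in> A" for i
        using that \<open>\<forall>a\<in>{i. B i \<noteq> A} \<inter> A. g a = f a\<close> g B(1)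
        by (cases "B i = A") (auto simp: PiE_iff)
      then have "g \<in> (\<Pi>\<^sub>E i\<in>A. B i)"
        using g by (auto simp: PiE_iff)
      then show ?thesis
        using B(3) V(2) that(1) by auto
    qed
    then show ?thesis
      using B(2) by (intro exI[of _ "{i. B i \<noteq> A} \<inter> A"]) auto
  qed
  then show ?R
    using V by auto
next
  assume R: ?R
  show ?L
  proof (subst openin_subopen, intro ballI)
    fix f assume f: "f \<in> U"
    then obtain F where F: "finite F" "F \<subseteq> A" "\<forall>g\<in>X. (\<forall>a\<in>F. g a = f a) \<longrightarrow> g \<in> U"
      using R by blast
    let ?N = "{g \<in> A \<rightarrow>\<^sub>E A. \<forall>a\<in>F \<inter> A. g a = f a} \<inter> X"
    have "openin (subtopology (Tr_topology A) X) ?N"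
      using openin_agree_Tr[OF F(1)] by (auto simp: openin_subtopology)
    moreover have "f \<in> ?N"
      using f R X by auto
    moreover have "?N \<subseteq> U"
      using F by blast
    ultimately show "\<exists>T. openin (subtopology (Tr_topology A) X) T \<and> f \<in> T \<and> T \<subseteq> U"
      by blast
  qed
qed

lemma openin_Tr_iff:
  "openin (Tr_topology A) U \<longleftrightarrow>
    U \<subseteq> A \<rightarrow>\<^sub>E A \<and>
    (\<forall>f\<in>U. \<exists>F. finite F \<and> F \<subseteq> A \<and> (\<forall>g\<in>A \<rightarrow>\<^sub>E A. (\<forall>a\<in>F. g a = f a) \<longrightarrow> g \<in> U))"
  using openin_subtopology_Tr_iff[of "A \<rightarrow>\<^sub>E A" A U]
  by (simp flip: topspace_Tr_topology add: subtopology_topspace)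

lemma closedin_Tr_memI:
  assumes "closedin (Tr_topology A) C" "u \<in> A \<rightarrow>\<^sub>E A"
    and approx: "\<And>W. finite W \<Longrightarrow> W \<subseteq> A \<Longrightarrow> \<exists>e\<in>C. \<forall>w\<in>W. e w = u w"
  shows "u \<in> C"
proof (rule ccontr)
  assume "u \<notin> C"
  moreover have "openin (Tr_topology A) ((A \<rightarrow>\<^sub>E A) - C)"
    using assms(1) by (simp add: closedin_def topspace_Tr_topology)
  ultimately obtain F where "finite F" "F \<subseteq> A"
      "\<forall>g\<in>A \<rightarrow>\<^sub>E A. (\<forall>a\<in>F. g a = u a) \<longrightarrow> g \<in> (A \<rightarrow>\<^sub>E A) - C"
    using assms(2) unfolding openin_Tr_iff by blast
  moreover have "C \<subseteq> A \<rightarrow>\<^sub>E A"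
    using closedin_subset[OF assms(1)] by (simp add: topspace_Tr_topology)
  ultimately show False
    using approx[of F] by blast
qed

lemma continuous_map_subtopology_TrI:
  assumes X: "X \<subseteq> A \<rightarrow>\<^sub>E A" and Y: "Y \<subseteq> B \<rightarrow>\<^sub>E B" and h: "h \<in> X \<rightarrow> Y"
    and loc: "\<And>f b. f \<in> X \<Longrightarrow> b \<in> B \<Longrightarrow>
      \<exists>F. finite F \<and> F \<subseteq> A \<and> (\<forall>g\<in>X. (\<forall>a\<in>F. g a = f a) \<longrightarrow> h g b = h f b)"
  shows "continuous_map (subtopology (Tr_topology A) X) (subtopology (Tr_topology B) Y) h"
proof -
  have "openin (subtopology (Tr_topology A) X) {f \<in> X. h f \<in> V}"
    if V: "openin (subtopology (Tr_topology B) Y) V" for V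
    unfolding openin_subtopology_Tr_iff[OF X]
  proof (intro conjI ballI)
    fix f assume f: "f \<in> {f \<in> X. h f \<in> V}"
    then obtain W where W: "finite W" "W \<subseteq> B" "\<forall>g\<in>Y. (\<forall>b\<in>W. g b = h f b) \<longrightarrow> g \<in> V"
      using V unfolding openin_subtopology_Tr_iff[OF Y] by blast
    have "\<forall>b\<in>W. \<exists>F. finite F \<and> F \<subseteq> A \<and> (\<forall>g\<in>X. (\<forall>a\<in>F. g a = f a) \<longrightarrow> h g b = h f b)"
      using loc f W(2) by blast
    then obtain F where
      F: "\<forall>b\<in>W. finite (F b) \<and> F b \<subseteq> A \<and> (\<forall>g\<in>X. (\<forall>a\<in>F b. g a = f a) \<longrightarrow> h g b = h f b)"
      by metis
    have "\<forall>g\<in>X. (\<forall>a\<in>\<Union>(F ` W). g a = f a) \<longrightarrow> g \<in> {f \<in> X. h f \<in> V}"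
      using F W(3) h by (auto simp: Pi_iff)
    then show "\<exists>F. finite F \<and> F \<subseteq> A \<and>
        (\<forall>g\<in>X. (\<forall>a\<in>F. g a = f a) \<longrightarrow> g \<in> {f \<in> X. h f \<in> V})"
      using F W(1) by (intro exI[of _ "\<Union>(F ` W)"]) auto
  qed auto
  moreover have "topspace (subtopology (Tr_topology A) X) = X"
      "topspace (subtopology (Tr_topology B) Y) = Y"
    using X Y by (auto simp: topspace_Tr_topology)
  ultimately show ?thesis
    using h by (auto simp: continuous_map_def)
qed

section \<open>Baire category\<close>

lemma completely_metrizable_space_Tr:
  "completely_metrizable_space (Tr_topology (UNIV :: 'a::countable set))"
  by (auto simp: Tr_topology_eq_product_topology completely_metrizable_space_product_topology
      completely_metrizable_space_discrete_topology)

text \<open>The Baire category theorem in terms of finite approximations: one of countably many pieces covering a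
G-delta set is dense in a basic neighbourhood \<open>{g \<in> X. \<forall>a\<in>F. g a = f a}\<close>. It serves twice: with cosets
of a stabilizer in the automorphism group, and to find a generic endomorphism.\<close>

lemma countable_cover_somewhere_dense:
  fixes X :: "('a::countable \<Rightarrow> 'a) set"
  assumes X: "gdelta_in (Tr_topology UNIV) X" "X \<noteq> {}"
    and I: "countable I" and cover: "X \<subseteq> (\<Union>i\<in>I. S i)" and S: "\<And>i. i \<in> I \<Longrightarrow> S i \<subseteq> X"
  obtains i f F where "i \<in> I" "f \<in> X" "finite F"
    "\<And>g F'. g \<in> X \<Longrightarrow> \<forall>a\<in>F. g a = f a \<Longrightarrow> finite F' \<Longrightarrow> \<exists>h\<in>S i. \<forall>a\<in>F'. h a = g a"
proof -
  define T where "T = subtopology (Tr_topology UNIV) X"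
  have top: "topspace T = X"
    by (simp add: T_def topspace_Tr_topology)
  have openT: "openin T U \<longleftrightarrow>
      U \<subseteq> X \<and> (\<forall>f\<in>U. \<exists>F. finite F \<and> (\<forall>g\<in>X. (\<forall>a\<in>F. g a = f a) \<longrightarrow> g \<in> U))" for U
    unfolding T_def using openin_subtopology_Tr_iff[of X UNIV U] by simp
  have cm: "completely_metrizable_space T"
    unfolding T_def
    by (rule completely_metrizable_space_gdelta_in[OF completely_metrizable_space_Tr X(1)])
  have "\<exists>i\<in>I. T interior_of (T closure_of S i) \<noteq> {}"
  proof (rule ccontr)
    assume "\<not> ?thesis"
    then have "T interior_of \<Union>((\<lambda>i. T closure_of S i) ` I) = {}"
      using cm I by (intro Baire_category_alt) auto
    moreover have "X \<subseteq> \<Union>((\<lambda>i. T closure_of S i) ` I)"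
      using cover S closure_of_subset[of _ T] top by blast
    then have "X \<subseteq> T interior_of \<Union>((\<lambda>i. T closure_of S i) ` I)"
      by (metis interior_of_maximal openin_topspace top)
    ultimately show False
      using X(2) by auto
  qed
  then obtain i f where i: "i \<in> I" and f: "f \<in> T interior_of (T closure_of S i)"
    by auto
  then obtain F where F: "finite F"
      "\<forall>g\<in>X. (\<forall>a\<in>F. g a = f a) \<longrightarrow> g \<in> T interior_of (T closure_of S i)"
    using openin_interior_of[of T "T closure_of S i"] unfolding openT by blast
  show ?thesis
  proof (rule that[OF i _ F(1)])
    show "f \<in> X"
      using f interior_of_subset_topspace[of T] top by blast
  next
    fix g F' assume g: "g \<in> X" "\<forall>a\<in>F. g a = f a" and F': "finite (F' :: 'a set)"
    have gc: "g \<in> T closure_of S i"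
      using F(2) g interior_of_subset[of T] by blast
    have "openin T {h \<in> X. \<forall>a\<in>F'. h a = g a}"
      unfolding openT using F' by fastforce
    moreover have "g \<in> {h \<in> X. \<forall>a\<in>F'. h a = g a}"
      using g(1) by simp
    ultimately obtain h where "h \<in> S i" "h \<in> {h \<in> X. \<forall>a\<in>F'. h a = g a}"
      using gc unfolding in_closure_of by meson
    then show "\<exists>h\<in>S i. \<forall>a\<in>F'. h a = g a"
      by auto
  qed
qed

section \<open>Order-preserving maps of the rationals\<close>

definition Aut_rat :: "(rat \<Rightarrow> rat) set" where
  "Aut_rat = {f. strict_mono f \<and> surj f}"

lemma strict_mono_in_End_rat: "strict_mono f \<Longrightarrow> f \<in> End_rat"
  by (auto simp: End_rat_def strict_mono_less_eq)

lemma Aut_rat_in_End_rat: "f \<in> Aut_rat \<Longrightarrow> f \<in> End_rat"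
  by (auto simp: Aut_rat_def strict_mono_in_End_rat)

lemma id_in_Aut_rat: "id \<in> Aut_rat"
  by (auto simp: Aut_rat_def strict_mono_def)

lemma comp_in_Aut_rat: "f \<in> Aut_rat \<Longrightarrow> g \<in> Aut_rat \<Longrightarrow> f \<circ> g \<in> Aut_rat"
  unfolding Aut_rat_def by (simp add: comp_surj strict_mono_o del: o_apply)

lemma bij_Aut_rat: "f \<in> Aut_rat \<Longrightarrow> bij f"
  by (auto simp: Aut_rat_def bij_def strict_mono_imp_inj_on)

lemma inv_in_Aut_rat:
  assumes "f \<in> Aut_rat"
  shows "inv_into UNIV f \<in> Aut_rat"
proof -
  have f: "strict_mono f" "surj f"
    using assms by (auto simp: Aut_rat_def)
  have "strict_mono (inv_into UNIV f)"
  proof (rule strict_monoI)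
    fix x y :: rat assume "x < y"
    then have "f (inv_into UNIV f x) < f (inv_into UNIV f y)"
      using f(2) by (simp add: surj_f_inv_f)
    then show "inv_into UNIV f x < inv_into UNIV f y"
      using f(1) by (simp add: strict_mono_less)
  qed
  moreover have "surj (inv_into UNIV f)"
    using f by (simp add: inj_imp_surj_inv strict_mono_imp_inj_on)
  ultimately show ?thesis
    by (auto simp: Aut_rat_def)
qed

lemma const_in_End_rat: "(\<lambda>_. q) \<in> End_rat"
  by (simp add: End_rat_def)

lemma id_in_End_rat: "id \<in> End_rat"
  by (simp add: End_rat_def)

lemma comp_in_End_rat: "f \<in> End_rat \<Longrightarrow> g \<in> End_rat \<Longrightarrow> f \<circ> g \<in> End_rat"
  by (simp add: End_rat_def)

lemma gdelta_in_Aut_rat: "gdelta_in (Tr_topology UNIV) Aut_rat"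
proof -
  let ?V = "(\<lambda>(p, q). {f :: rat \<Rightarrow> rat. f p < f q}) ` {(p, q). p < q} \<union> range (\<lambda>q. {f. \<exists>x. q = f x})"
  have *: "Aut_rat = \<Inter> ?V"
    unfolding Inter_Un_distrib by (auto simp: Aut_rat_def strict_mono_def surj_def)
  have lt: "openin (Tr_topology UNIV) {f :: rat \<Rightarrow> rat. f p < f q}" for p q
    unfolding openin_Tr_iff
    by (auto intro!: exI[of _ "{p, q}"])
  have ex: "openin (Tr_topology UNIV) {f :: rat \<Rightarrow> rat. \<exists>x. q = f x}" for q
    unfolding openin_Tr_iff
  proof (intro conjI ballI)
    fix f :: "rat \<Rightarrow> rat" assume "f \<in> {f. \<exists>x. q = f x}"
    then obtain x where "q = f x" by auto
    then show "\<exists>F. finite F \<and> F \<subseteq> UNIV \<and>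
        (\<forall>g\<in>UNIV \<rightarrow>\<^sub>E UNIV. (\<forall>a\<in>F. g a = f a) \<longrightarrow> g \<in> {f. \<exists>x. q = f x})"
      by (intro exI[of _ "{x}"]) (auto intro: exI[of _ x])
  qed auto
  show ?thesis
    unfolding *
    by (rule gdelta_in_Inter) (auto intro!: open_imp_gdelta_in lt ex)
qed

lemma gdelta_in_End_rat: "gdelta_in (Tr_topology UNIV) End_rat"
proof -
  let ?V = "(\<lambda>(p, q). {f :: rat \<Rightarrow> rat. f p \<le> f q}) ` {(p, q). p \<le> q}"
  have *: "End_rat = \<Inter> ?V"
    by (fastforce simp: End_rat_def)
  have le: "openin (Tr_topology UNIV) {f :: rat \<Rightarrow> rat. f p \<le> f q}" for p q
    unfolding openin_Tr_iff
    by (auto intro!: exI[of _ "{p, q}"])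
  have "{(p, q). p \<le> (q :: rat)} \<noteq> {}"
    by auto
  then show ?thesis
    unfolding *
    by (intro gdelta_in_Inter) (auto intro!: open_imp_gdelta_in le)
qed

text \<open>The extension is piecewise linear: a new largest point is reached by a segment of slope \<open>s\<close> from the
previous largest point, and the segment is prolonged to a half-line so that surjectivity persists.\<close>

lemma strict_mono_on_finite_extend:
  fixes g :: "'a::linordered_field \<Rightarrow> 'a"
  assumes "finite F" "strict_mono_on F g"
  shows "\<exists>h. strict_mono h \<and> surj h \<and> (\<forall>a\<in>F. h a = g a)"
  using assms
proof (induction F rule: finite_linorder_max_induct)
  case empty
  show ?case
    by (rule exI[of _ id]) (auto simp: strict_mono_def)
next
  case (insert b A)
  have "strict_mono_on A g"
    using insert.prems by (auto simp: strict_mono_on_def)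
  then obtain h where h: "strict_mono h" "surj h" "\<forall>a\<in>A. h a = g a"
    using insert.IH by blast
  show ?case
  proof (cases "A = {}")
    case True
    have "surj (\<lambda>x. x + (g b - b))"
      by (rule surjI[of _ "\<lambda>x. x - (g b - b)"]) simp
    then show ?thesis
      using True by (intro exI[of _ "\<lambda>x. x + (g b - b)"]) (auto simp: strict_mono_def)
  next
    case False
    define m where "m = Max A"
    have m: "m \<in> A" "\<And>a. a \<in> A \<Longrightarrow> a \<le> m"
      using False insert.hyps(1) by (auto simp: m_def)
    have "m < b"
      using insert.hyps(2) m(1) by blast
    have "g m < g b"
      using insert.prems \<open>m < b\<close> m(1) by (auto simp: strict_mono_on_def)
    define s where "s = (g b - g m) / (b - m)"
    have s: "s > 0" and s_eq: "(b - m) * s = g b - g m"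
      using \<open>m < b\<close> \<open>g m < g b\<close> by (simp_all add: s_def)
    define k where "k x = (if x \<le> m then h x else h m + (x - m) * s)" for x
    have above: "h m < k x" if "m < x" for x
      using that s by (simp add: k_def)
    have "k x < k y" if "x < y" for x y
    proof (cases "x \<le> m")
      case True
      show ?thesis
      proof (cases "y \<le> m")
        case True
        then show ?thesis
          using that h(1) by (simp add: k_def strict_mono_less)
      next
        case False
        have "k x \<le> h m"
          using \<open>x \<le> m\<close> h(1) by (simp add: k_def strict_mono_less_eq)
        then show ?thesis
          using above[of y] False by simp
      qed
    next
      case False
      then show ?thesis
        using that mult_strict_right_mono[OF _ s, of "x - m" "y - m"] by (simp add: k_def)
    qed
    then have "strict_mono k"
      by (simp add: strict_mono_def)
    moreover have "\<exists>x. y = k x" for y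
    proof (cases "y \<le> h m")
      case True
      obtain x where "h x = y"
        using h(2) by (metis surjD)
      then have "k x = y"
        using True h(1) by (auto simp: k_def strict_mono_less_eq)
      then show ?thesis by auto
    next
      case False
      have "k (m + (y - h m) / s) = h m + ((y - h m) / s) * s"
        using False divide_pos_pos[OF _ s, of "y - h m"] unfolding k_def by auto
      also have "\<dots> = y"
        using s by simp
      finally show ?thesis by (intro exI[of _ "m + (y - h m) / s"]) simp
    qed
    then have "surj k"
      by (auto simp: surj_def)
    moreover have "\<forall>a\<in>insert b A. k a = g a"
      using m h(3) \<open>m < b\<close> s_eq by (auto simp: k_def)
    ultimately show ?thesis by blast
  qed
qed

lemma finite_sets_separated:
  fixes A B :: "'a::{dense_linorder, no_bot, no_top} set"
  assumes "finite A" "finite B" "\<And>a b. a \<in> A \<Longrightarrow> b \<in> B \<Longrightarrow> a < b"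
  shows "\<exists>u. (\<forall>a\<in>A. a < u) \<and> (\<forall>b\<in>B. u < b)"
proof (cases "A = {} \<or> B = {}")
  case True
  obtain u v where "B \<noteq> {} \<Longrightarrow> u < Min B" "A \<noteq> {} \<Longrightarrow> Max A < v"
    using lt_ex gt_ex by metis
  then show ?thesis
    using True assms(1,2) by (cases "A = {}"; cases "B = {}") auto
next
  case False
  then have "Max A < Min B"
    using assms by simp
  then obtain u where "Max A < u" "u < Min B"
    using dense by blast
  then show ?thesis
    using False assms(1,2) by (intro exI[of _ u]) auto
qed

text \<open>Having two points in the fibre over \<open>c\<close> is a dense condition: given finitely many values of \<open>f\<close>, the
arguments where the value is prescribed to be below \<open>c\<close> and those where it is prescribed to be above
\<open>c\<close> are separated by an open interval, and \<open>f\<close> may be changed to \<open>c\<close> on all of it. Hence, by Baire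
category, some endomorphism satisfies the condition for all \<open>c\<close> at once. In a direct construction one
would have to keep every rational number out of the irrational cuts between the fibres.\<close>

lemma End_rat_generic_fibres:
  obtains p where "p \<in> End_rat" "\<forall>c. \<exists>x y. x < y \<and> p x = c \<and> p y = c"
proof -
  define S where "S c = {p \<in> End_rat. \<not> (\<exists>x y. x < y \<and> p x = c \<and> p y = c)}" for c
  have "\<not> End_rat \<subseteq> (\<Union>c. S c)"
  proof
    assume cover: "End_rat \<subseteq> (\<Union>c. S c)"
    obtain c f F where f: "f \<in> End_rat" and F: "finite F"
      and dense: "\<And>g F'. g \<in> End_rat \<Longrightarrow> \<forall>a\<in>F. g a = f a \<Longrightarrow> finite F' \<Longrightarrow>
        \<exists>h\<in>S c. \<forall>a\<in>F'. h a = g a"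
      by (rule countable_cover_somewhere_dense[OF gdelta_in_End_rat _ _ cover])
        (use id_in_End_rat in \<open>auto simp: S_def\<close>)
    have fm: "f x \<le> f y" if "x \<le> y" for x y
      using f that by (simp add: End_rat_def)
    \<comment> \<open>Monotonicity forces the value to stay below \<open>c\<close> on \<open>lo\<close> and above \<open>c\<close> on \<open>hi\<close>.\<close>
    define lo where "lo x \<longleftrightarrow> (\<exists>a\<in>F. f a < c \<and> x \<le> a)" for x
    define hi where "hi x \<longleftrightarrow> (\<exists>b\<in>F. c < f b \<and> b \<le> x)" for x
    define g where "g x = (if lo x \<or> hi x then f x else c)" for x
    have lo: "f x < c" if "lo x" for x
      using that fm by (fastforce simp: lo_def)
    have hi: "c < f x" if "hi x" for x
      using that fm by (fastforce simp: hi_def)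
    have "lo x" if "lo y" "x \<le> y" for x y
      using that by (fastforce simp: lo_def)
    moreover have "hi y" if "hi x" "x \<le> y" for x y
      using that by (fastforce simp: hi_def)
    ultimately have "g x \<le> g y" if "x \<le> y" for x y
      using that fm[OF that] lo[of x] hi[of y]
      by (cases "lo x \<or> hi x"; cases "lo y \<or> hi y") (auto simp: g_def less_imp_le)
    then have "g \<in> End_rat"
      by (simp add: End_rat_def)
    moreover have "\<forall>a\<in>F. g a = f a"
      by (force simp: g_def lo_def hi_def)
    moreover obtain x y where "x < y" "g x = c" "g y = c"
    proof -
      let ?A = "{a\<in>F. f a < c}" and ?B = "{b\<in>F. c < f b}"
      have AB: "a < b" if "a \<in> ?A" "b \<in> ?B" for a b
        using that fm[of b a] by (cases "a < b") auto
      have "\<exists>u. (\<forall>a\<in>?A. a < u) \<and> (\<forall>b\<in>?B. u < b)"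
        by (rule finite_sets_separated[OF _ _ AB]) (use F in simp_all)
      then obtain u where u: "\<forall>a\<in>?A. a < u" "\<forall>b\<in>?B. u < b"
        by blast
      have "\<exists>v. (\<forall>a\<in>insert u ?A. a < v) \<and> (\<forall>b\<in>?B. v < b)"
      proof (rule finite_sets_separated)
        show "a < b" if "a \<in> insert u ?A" "b \<in> ?B" for a b
          using that AB u(2) by blast
      qed (use F in simp_all)
      then obtain v where v: "\<forall>a\<in>insert u ?A. a < v" "\<forall>b\<in>?B. v < b"
        by blast
      have "u < v"
        using v(1) by simp
      moreover have "\<not> lo w \<and> \<not> hi w" if "w \<in> {u, v}" for w
        using that u v by (fastforce simp: lo_def hi_def)
      then have "g u = c" "g v = c"
        by (simp_all add: g_def)
      ultimately show ?thesis
        by (rule that)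
    qed
    ultimately obtain h where "h \<in> S c" "\<forall>a\<in>{x, y}. h a = g a"
      using dense[of g "{x, y}"] by blast
    then show False
      using \<open>x < y\<close> \<open>g x = c\<close> \<open>g y = c\<close> by (auto simp: S_def)
  qed
  then obtain p where "p \<in> End_rat" "\<forall>c. p \<notin> S c"
    by blast
  then have "\<forall>c. \<exists>x y. x < y \<and> p x = c \<and> p y = c"
    unfolding S_def by blast
  then show ?thesis
    using that \<open>p \<in> End_rat\<close> by blast
qed

text \<open>An increasing parameter with values strictly between 0 and 1 squeezes all of the ordered field into
any prescribed interval.\<close>

lemma strict_mono_into_unit_interval:
  obtains \<sigma> :: "'a::linordered_field \<Rightarrow> 'a"
  where "strict_mono \<sigma>" "\<forall>x. 0 < \<sigma> x \<and> \<sigma> x < 1"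
proof
  let ?r = "\<lambda>x :: 'a. x / (1 + \<bar>x\<bar>)"
  have pos: "0 < 1 + \<bar>x\<bar>" for x :: 'a
    by (simp add: add_pos_nonneg)
  have r: "-1 < ?r x" "?r x < 1" for x
    using pos[of x] by (simp_all add: pos_less_divide_eq pos_divide_less_eq)
  have "?r x < ?r y" if "x < y" for x y
  proof -
    have "x * (1 + \<bar>y\<bar>) < y * (1 + \<bar>x\<bar>)"
    proof (cases "x < 0 \<and> 0 < y")
      case True
      then have "x * (1 + \<bar>y\<bar>) < 0" "0 < y * (1 + \<bar>x\<bar>)"
        using pos by (simp_all add: mult_neg_pos)
      then show ?thesis by simp
    next
      case False
      then have "x * \<bar>y\<bar> = y * \<bar>x\<bar>"
        using that by (cases "0 \<le> x") (auto simp: abs_if not_less)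
      then show ?thesis
        using that by (simp add: distrib_left)
    qed
    then show ?thesis
      using pos by (simp add: frac_less_eq divide_less_eq less_divide_eq field_simps)
  qed
  then show "strict_mono (\<lambda>x. (1 + ?r x) / 2)"
    unfolding strict_mono_def by (intro allI impI divide_strict_right_mono add_strict_left_mono) simp_all
  show "\<forall>x. 0 < (1 + ?r x) / 2 \<and> (1 + ?r x) / 2 < 1"
  proof
    show "0 < (1 + ?r x) / 2 \<and> (1 + ?r x) / 2 < 1" for x
      using r[of x] by simp
  qed
qed

text \<open>If every fibre of \<open>p\<close> contains two points \<open>l c < r c\<close>, it contains the whole interval between them.
Sending \<open>x\<close> into the interval over \<open>f x\<close>, at a relative position that increases with \<open>x\<close>, makes \<open>f\<close>
injective without destroying monotonicity, and \<open>p\<close> undoes the change. What matters is that \<open>p\<close> and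
\<open>\<tau>\<close> are the same for all \<open>f\<close>, so that a neighbourhood of \<open>f\<close> is obtained from a neighbourhood of the
embedding.\<close>

lemma End_rat_factor_through_embedding:
  obtains p \<tau> where "p \<in> End_rat"
    "\<And>f. f \<in> End_rat \<Longrightarrow> strict_mono (\<lambda>x. \<tau> x (f x))"
    "\<And>f. f \<in> End_rat \<Longrightarrow> p \<circ> (\<lambda>x. \<tau> x (f x)) = f"
proof -
  obtain p where p: "p \<in> End_rat" and "\<forall>c. \<exists>x y. x < y \<and> p x = c \<and> p y = c"
    by (rule End_rat_generic_fibres)
  then obtain l r where lr: "\<And>c. l c < r c" "\<And>c. p (l c) = c" "\<And>c. p (r c) = c"
    by metis
  obtain \<sigma> :: "rat \<Rightarrow> rat" where \<sigma>: "strict_mono \<sigma>" "\<forall>x. 0 < \<sigma> x \<and> \<sigma> x < 1"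
    by (rule strict_mono_into_unit_interval)
  have pm: "p x \<le> p y" if "x \<le> y" for x y
    using p that by (simp add: End_rat_def)
  define \<tau> where "\<tau> x c = l c + (r c - l c) * \<sigma> x" for x c
  have \<tau>_mono: "\<tau> x c < \<tau> y c" if "x < y" for x y c
    using that lr(1)[of c] \<sigma>(1) by (simp add: \<tau>_def strict_mono_less)
  have p\<tau>: "p (\<tau> x c) = c" for x c
  proof (rule antisym)
    have "(r c - l c) * \<sigma> x \<le> (r c - l c) * 1"
      using lr(1)[of c] \<sigma>(2) by (intro mult_left_mono) (simp_all add: less_imp_le)
    then show "p (\<tau> x c) \<le> c"
      using pm[of "\<tau> x c" "r c"] lr(3)[of c] by (simp add: \<tau>_def)
    have "0 \<le> (r c - l c) * \<sigma> x"
      using lr(1)[of c] \<sigma>(2) by (simp add: less_imp_le)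
    then show "c \<le> p (\<tau> x c)"
      using pm[of "l c" "\<tau> x c"] lr(2)[of c] by (simp add: \<tau>_def)
  qed
  have "\<tau> x (f x) < \<tau> y (f y)" if f: "f \<in> End_rat" and "x < y" for f x y
  proof (cases "f x = f y")
    case True
    then show ?thesis
      using \<tau>_mono[OF \<open>x < y\<close>] by simp
  next
    case False
    then have "p (\<tau> x (f x)) < p (\<tau> y (f y))"
      using f \<open>x < y\<close> by (simp add: p\<tau> End_rat_def order_less_le)
    then show ?thesis
      using pm by (meson linorder_not_less)
  qed
  then show ?thesis
    using that[of p \<tau>] p p\<tau> by (simp add: strict_mono_def fun_eq_iff)
qed

section \<open>Closed representations of the endomorphism monoid\<close>

locale closed_representation =
  fixes \<Omega> :: "'b set"
    and E' :: "('b \<Rightarrow> 'b) set"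
    and \<theta> :: "(rat \<Rightarrow> rat) \<Rightarrow> ('b \<Rightarrow> 'b)"
  assumes countable: "countable \<Omega>"
    and submonoid: "submonoid E' (Tr \<Omega>)"
    and closed: "closedin (Tr_topology \<Omega>) E'"
    and iso: "\<theta> \<in> iso ((Tr UNIV)\<lparr>carrier := End_rat\<rparr>) ((Tr \<Omega>)\<lparr>carrier := E'\<rparr>)"
begin

lemma E'_subset: "E' \<subseteq> \<Omega> \<rightarrow>\<^sub>E \<Omega>"
  using submonoid.subset[OF submonoid] by (simp add: Tr_def)

lemma bij_betw_\<theta>: "bij_betw \<theta> End_rat E'"
  using iso by (simp add: iso_def)

lemma \<theta>_in_E': "f \<in> End_rat \<Longrightarrow> \<theta> f \<in> E'"
  using bij_betw_\<theta> by (auto simp: bij_betw_def)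

lemma \<theta>_in_\<Omega>: "f \<in> End_rat \<Longrightarrow> w \<in> \<Omega> \<Longrightarrow> \<theta> f w \<in> \<Omega>"
  using \<theta>_in_E' E'_subset by blast

lemma \<theta>_comp:
  assumes "f \<in> End_rat" "g \<in> End_rat" "w \<in> \<Omega>"
  shows "\<theta> (f \<circ> g) w = \<theta> f (\<theta> g w)"
proof -
  have "\<theta> (f \<circ> g) = compose \<Omega> (\<theta> f) (\<theta> g)"
    using iso assms unfolding iso_def hom_def Tr_UNIV by (auto simp: Tr_def)
  then show ?thesis
    using assms(3) by (simp add: compose_def)
qed

lemma \<theta>_id:
  assumes "w \<in> \<Omega>"
  shows "\<theta> id w = w"
proof -
  have "(\<lambda>x\<in>\<Omega>. x) \<in> E'"
    using submonoid.one_closed[OF submonoid] by (simp add: Tr_def)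
  then obtain e where e: "e \<in> End_rat" "\<theta> e = (\<lambda>x\<in>\<Omega>. x)"
    using bij_betw_\<theta> by (metis bij_betw_def imageE)
  have "\<theta> (id \<circ> e) w = \<theta> id (\<theta> e w)"
    using e(1) assms id_in_End_rat by (intro \<theta>_comp)
  then show ?thesis
    using e(2) assms by simp
qed

lemma \<theta>_inv:
  assumes f: "f \<in> Aut_rat" and w: "w \<in> \<Omega>"
  shows "\<theta> (inv_into UNIV f) (\<theta> f w) = w"
proof -
  have "inv_into UNIV f \<circ> f = id"
    using bij_Aut_rat[OF f] by (simp add: bij_is_inj)
  then show ?thesis
    using \<theta>_comp[of "inv_into UNIV f" f w] f w
    by (simp add: Aut_rat_in_End_rat inv_in_Aut_rat \<theta>_id)
qed

text \<open>The constants behave like the points of \<open>\<rat>\<close>: for fixed \<open>w\<close>, the map \<open>q \<mapsto> \<theta> (\<lambda>_. q) w\<close> intertwines the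
action of \<open>E\<close> on \<open>\<rat>\<close> with its action on \<open>\<Omega>\<close>.\<close>

lemma \<theta>_const:
  assumes "f \<in> End_rat" "w \<in> \<Omega>"
  shows "\<theta> f (\<theta> (\<lambda>_. q) w) = \<theta> (\<lambda>_. f q) w"
  using \<theta>_comp[OF assms(1) const_in_End_rat assms(2), of q] by (simp add: comp_def)

text \<open>If the equivariant map identified \<open>a < b\<close>, it would identify 0 and 1, since a step function in \<open>E\<close>
sends \<open>a\<close> to 0 and \<open>b\<close> to 1. Faithfulness of the action provides a \<open>w\<close> that tells 0 and 1 apart.\<close>

lemma equivariant_embedding:
  obtains w where "w \<in> \<Omega>" "inj (\<lambda>q. \<theta> (\<lambda>_. q) w)"
proof -
  have "\<theta> (\<lambda>_. 0) \<noteq> \<theta> (\<lambda>_. 1)"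
  proof
    assume "\<theta> (\<lambda>_. 0) = \<theta> (\<lambda>_. 1)"
    then have "(\<lambda>_. 0) = (\<lambda>_ :: rat. 1 :: rat)"
      by (rule inj_onD[OF bij_betw_imp_inj_on[OF bij_betw_\<theta>]]) (rule const_in_End_rat)+
    then show False
      by (simp add: fun_eq_iff)
  qed
  moreover have "\<theta> (\<lambda>_. q) \<in> \<Omega> \<rightarrow>\<^sub>E \<Omega>" for q
    using \<theta>_in_E'[OF const_in_End_rat] E'_subset by blast
  ultimately obtain w where w: "w \<in> \<Omega>" "\<theta> (\<lambda>_. 0) w \<noteq> \<theta> (\<lambda>_. 1) w"
    by (meson PiE_ext)
  have ne: "\<theta> (\<lambda>_. a) w \<noteq> \<theta> (\<lambda>_. b) w" if "a < b" for a b
  proof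
    assume eq: "\<theta> (\<lambda>_. a) w = \<theta> (\<lambda>_. b) w"
    define f :: "rat \<Rightarrow> rat" where "f x = (if x \<le> a then 0 else 1)" for x
    have "f \<in> End_rat"
      by (auto simp: f_def End_rat_def)
    then have "\<theta> (\<lambda>_. f a) w = \<theta> (\<lambda>_. f b) w"
      using eq \<theta>_const[OF _ w(1)] by metis
    then show False
      using w(2) that by (simp add: f_def)
  qed
  have "inj (\<lambda>q. \<theta> (\<lambda>_. q) w)"
  proof (rule injI)
    fix a b assume "\<theta> (\<lambda>_. a) w = \<theta> (\<lambda>_. b) w"
    then show "a = b"
      using ne[of a b] ne[of b a] by (cases a b rule: linorder_cases) auto
  qed
  then show thesis
    using that w(1) by blast
qed

text \<open>This is the continuity of the inverse of \<open>\<theta>\<close>: the value of \<open>f\<close> at \<open>q\<close> can be read off from the action of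
\<open>f\<close> on the single point of \<open>\<Omega>\<close> that represents \<open>q\<close>.\<close>

lemma \<theta>_inverse_local:
  obtains w where "w \<in> \<Omega>"
    "\<And>f g. f \<in> End_rat \<Longrightarrow> g \<in> End_rat \<Longrightarrow> \<theta> f w = \<theta> g w \<Longrightarrow> f q = g q"
proof -
  obtain w where w: "w \<in> \<Omega>" "inj (\<lambda>q. \<theta> (\<lambda>_. q) w)"
    by (rule equivariant_embedding)
  show thesis
  proof
    show "\<theta> (\<lambda>_. q) w \<in> \<Omega>"
      using w(1) const_in_End_rat by (rule \<theta>_in_\<Omega>[rotated])
  next
    fix f g assume "f \<in> End_rat" "g \<in> End_rat"
      and "\<theta> f (\<theta> (\<lambda>_. q) w) = \<theta> g (\<theta> (\<lambda>_. q) w)"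
    then have "\<theta> (\<lambda>_. f q) w = \<theta> (\<lambda>_. g q) w"
      using w(1) by (simp add: \<theta>_const)
    then show "f q = g q"
      using w(2) by (auto dest: injD)
  qed
qed

text \<open>Closedness of \<open>E'\<close> enters here, and it is indispensable: let \<open>E\<close> act on \<open>\<rat>\<close> together with two extra
points, which are collapsed to one of them by the maps that are bounded above and fixed by the others.
This action is faithful but discontinuous, and its image is not closed. In the proof, \<open>u\<close> is \<open>\<theta> f\<close> for some \<open>f\<close>, and continuity of the inverse forces \<open>f = g\<close>.\<close>

lemma closed_graph:
  assumes u: "u \<in> \<Omega> \<rightarrow>\<^sub>E \<Omega>"
    and approx: "\<And>W Q. finite W \<Longrightarrow> W \<subseteq> \<Omega> \<Longrightarrow> finite Q \<Longrightarrow>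
      \<exists>h\<in>End_rat. (\<forall>w\<in>W. \<theta> h w = u w) \<and> (\<forall>q\<in>Q. h q = g q)"
  shows "\<theta> g = u"
proof -
  have "u \<in> E'"
  proof (rule closedin_Tr_memI[OF closed u])
    fix W assume "finite W" "W \<subseteq> \<Omega>"
    then obtain h where "h \<in> End_rat" "\<forall>w\<in>W. \<theta> h w = u w"
      using approx[of W "{}"] by blast
    then show "\<exists>e\<in>E'. \<forall>w\<in>W. e w = u w"
      using \<theta>_in_E' by blast
  qed
  then obtain f where f: "f \<in> End_rat" "u = \<theta> f"
    using bij_betw_\<theta> by (metis bij_betw_def imageE)
  have "f q = g q" for q
  proof -
    obtain w where w: "w \<in> \<Omega>"
      "\<And>f g. f \<in> End_rat \<Longrightarrow> g \<in> End_rat \<Longrightarrow> \<theta> f w = \<theta> g w \<Longrightarrow> f q = g q"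
      by (rule \<theta>_inverse_local[where q = q]) blast
    obtain h where "h \<in> End_rat" "\<theta> h w = u w" "h q = g q"
      using approx[of "{w}" "{q}"] w(1) by auto
    then show ?thesis
      using w(2)[of h f] f by simp
  qed
  then show ?thesis
    using f(2) by (metis ext)
qed

text \<open>If two elements \<open>h1\<close>, \<open>h2\<close> of one class \<open>S v\<close> approximate \<open>f\<close> and \<open>f \<circ> k\<close>, then \<open>inv h1 \<circ> h2\<close>
approximates \<open>k\<close> and fixes \<open>W\<close> pointwise. The class only has to be dense near \<open>f\<close>, which holds for
some class by Baire category.\<close>

lemma stabilizer_somewhere_dense:
  assumes W: "finite W" "W \<subseteq> \<Omega>"
  obtains F where "finite F"
    "\<And>k F'. k \<in> Aut_rat \<Longrightarrow> \<forall>a\<in>F. k a = a \<Longrightarrow> finite F' \<Longrightarrow>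
      \<exists>h\<in>Aut_rat. (\<forall>a\<in>F'. h a = k a) \<and> (\<forall>w\<in>W. \<theta> h w = w)"
proof -
  define S where "S v = {g \<in> Aut_rat. \<forall>w\<in>W. \<theta> g w = v w}" for v
  have cover: "Aut_rat \<subseteq> (\<Union>v\<in>W \<rightarrow>\<^sub>E \<Omega>. S v)"
  proof
    fix g assume g: "g \<in> Aut_rat"
    then have "restrict (\<theta> g) W \<in> W \<rightarrow>\<^sub>E \<Omega>" "g \<in> S (restrict (\<theta> g) W)"
      using W(2) \<theta>_in_\<Omega> Aut_rat_in_End_rat by (auto simp: S_def)
    then show "g \<in> (\<Union>v\<in>W \<rightarrow>\<^sub>E \<Omega>. S v)"
      by blast
  qed
  have W_countable: "countable (W \<rightarrow>\<^sub>E \<Omega>)"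
    using W(1) countable by (intro countable_PiE)
  obtain v f F where f: "f \<in> Aut_rat" and F: "finite F"
    and dense: "\<And>g F'. g \<in> Aut_rat \<Longrightarrow> \<forall>a\<in>F. g a = f a \<Longrightarrow> finite F' \<Longrightarrow>
      \<exists>h\<in>S v. \<forall>a\<in>F'. h a = g a"
    by (rule countable_cover_somewhere_dense[OF gdelta_in_Aut_rat _ W_countable cover])
      (use id_in_Aut_rat in \<open>auto simp: S_def\<close>)
  show thesis
  proof (rule that[OF F])
    fix k F' assume k: "k \<in> Aut_rat" "\<forall>a\<in>F. k a = a" and F': "finite (F' :: rat set)"
    \<comment> \<open>\<open>h1\<close> must match \<open>f\<close> where \<open>k\<close> takes its values, so that \<open>h1 (k a) = f (k a) = h2 a\<close>.\<close>
    obtain h1 where h1: "h1 \<in> S v" "\<forall>a\<in>k ` F'. h1 a = f a"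
      using dense[OF f, of "k ` F'"] F' by auto
    obtain h2 where h2: "h2 \<in> S v" "\<forall>a\<in>F'. h2 a = f (k a)"
      using dense[of "f \<circ> k" F'] comp_in_Aut_rat[OF f k(1)] k(2) F' by auto
    have A: "h1 \<in> Aut_rat" "h2 \<in> Aut_rat"
      using h1 h2 by (auto simp: S_def)
    let ?h = "inv_into UNIV h1 \<circ> h2"
    have "?h \<in> Aut_rat"
      using A by (simp add: comp_in_Aut_rat inv_in_Aut_rat del: o_apply)
    moreover have "?h a = k a" if "a \<in> F'" for a
    proof -
      have "h2 a = h1 (k a)"
        using h1(2) h2(2) that by simp
      then show ?thesis
        using bij_Aut_rat[OF A(1)] by (simp add: bij_is_inj)
    qed
    moreover have "\<theta> ?h w = w" if "w \<in> W" for w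
    proof -
      have w: "w \<in> \<Omega>"
        using that W(2) by blast
      have "\<theta> ?h w = \<theta> (inv_into UNIV h1) (\<theta> h2 w)"
        using A w by (intro \<theta>_comp Aut_rat_in_End_rat inv_in_Aut_rat)
      also have "\<theta> h2 w = \<theta> h1 w"
        using h1(1) h2(1) that by (simp add: S_def)
      also have "\<theta> (inv_into UNIV h1) (\<theta> h1 w) = w"
        using A(1) w by (rule \<theta>_inv)
      finally show ?thesis .
    qed
    ultimately show "\<exists>h\<in>Aut_rat. (\<forall>a\<in>F'. h a = k a) \<and> (\<forall>w\<in>W. \<theta> h w = w)"
      by blast
  qed
qed

text \<open>Given \<open>g\<close> near the identity, automorphisms \<open>P n\<close> are chosen that approach \<open>g\<close> on \<open>\<rat>\<close>, always fix \<open>x\<close>,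
and whose action on a growing finite part \<open>W n\<close> of \<open>\<Omega>\<close> stays the same from stage \<open>n\<close> on. Each correction
lies in the stabilizer of \<open>W n\<close> and is supplied by its density, because the remaining error
\<open>inv (P n) \<circ> g\<close> lies in the corresponding basic open subgroup. So \<open>\<theta> (P n)\<close> converges, and by the closed
graph its limit is \<open>\<theta> g\<close>.\<close>

lemma stabilizer_open:
  assumes x: "x \<in> \<Omega>"
  obtains F where "finite F" "\<And>g. g \<in> Aut_rat \<Longrightarrow> \<forall>a\<in>F. g a = a \<Longrightarrow> \<theta> g x = x"
proof -
  define W where "W n = insert x (from_nat_into \<Omega> ` {..n})" for n
  have W: "finite (W n)" "W n \<subseteq> \<Omega>" "x \<in> W n" for n
    using x from_nat_into[of \<Omega>] by (auto simp: W_def)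
  have "\<exists>F. finite F \<and> (\<forall>k F'. k \<in> Aut_rat \<longrightarrow> (\<forall>a\<in>F. k a = a) \<longrightarrow> finite F' \<longrightarrow>
      (\<exists>h\<in>Aut_rat. (\<forall>a\<in>F'. h a = k a) \<and> (\<forall>w\<in>W n. \<theta> h w = w)))" for n
    by (rule stabilizer_somewhere_dense[OF W(1,2)[of n]]) blast
  then obtain \<Phi> where \<Phi>: "\<And>n. finite (\<Phi> n)"
    "\<And>n k F'. k \<in> Aut_rat \<Longrightarrow> \<forall>a\<in>\<Phi> n. k a = a \<Longrightarrow> finite F' \<Longrightarrow>
      \<exists>h\<in>Aut_rat. (\<forall>a\<in>F'. h a = k a) \<and> (\<forall>w\<in>W n. \<theta> h w = w)"
    by metis
  \<comment> \<open>The first part keeps the error where the density applies, the second makes \<open>P n\<close> converge to \<open>g\<close>.\<close>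
  define F where "F n = \<Phi> n \<union> from_nat ` {..n}" for n
  have F: "finite (F n)" for n
    using \<Phi>(1) by (simp add: F_def)
  show thesis
  proof (rule that[OF F[of 0]])
    fix g assume g: "g \<in> Aut_rat" "\<forall>a\<in>F 0. g a = a"
    let ?P = "\<lambda>n p. p \<in> Aut_rat \<and> (\<forall>a\<in>F n. p a = g a) \<and> \<theta> p x = x"
    have "\<exists>P. \<forall>n. ?P n (P n) \<and> (\<forall>w\<in>W n. \<theta> (P (Suc n)) w = \<theta> (P n) w)"
    proof (rule dependent_nat_choice)
      show "\<exists>p. ?P 0 p"
        using g x by (intro exI[of _ id]) (simp add: id_in_Aut_rat \<theta>_id)
    next
      fix p n assume p: "?P n p"
      define k where "k = inv_into UNIV p \<circ> g"
      have bij: "bij p"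
        using p bij_Aut_rat by blast
      have k: "k \<in> Aut_rat"
        unfolding k_def using p g(1) by (intro comp_in_Aut_rat inv_in_Aut_rat) auto
      have "\<forall>a\<in>\<Phi> n. g a = p a"
        using p by (simp add: F_def)
      then have "\<forall>a\<in>\<Phi> n. k a = a"
        using bij by (simp add: k_def bij_is_inj)
      then obtain h where h: "h \<in> Aut_rat" "\<forall>a\<in>F (Suc n). h a = k a" "\<forall>w\<in>W n. \<theta> h w = w"
        using \<Phi>(2)[OF k _ F[of "Suc n"]] by blast
      have comp: "\<theta> (p \<circ> h) w = \<theta> p w" if "w \<in> W n" for w
      proof -
        have "\<theta> (p \<circ> h) w = \<theta> p (\<theta> h w)"
          using p h(1) that W(2) by (intro \<theta>_comp Aut_rat_in_End_rat) auto
        then show ?thesis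
          using h(3) that by simp
      qed
      have "(p \<circ> h) a = g a" if "a \<in> F (Suc n)" for a
        using h(2) that bij by (simp add: k_def bij_is_surj surj_f_inv_f)
      moreover have "p \<circ> h \<in> Aut_rat"
        using p h(1) by (intro comp_in_Aut_rat) auto
      moreover have "\<theta> (p \<circ> h) x = x"
        using comp[OF W(3)] p by simp
      ultimately show "\<exists>p'. ?P (Suc n) p' \<and> (\<forall>w\<in>W n. \<theta> p' w = \<theta> p w)"
        using comp by (intro exI[of _ "p \<circ> h"]) blast
    qed
    then obtain P where P: "\<And>n. P n \<in> Aut_rat" "\<And>n a. a \<in> F n \<Longrightarrow> P n a = g a"
        "\<And>n. \<theta> (P n) x = x" "\<And>n w. w \<in> W n \<Longrightarrow> \<theta> (P (Suc n)) w = \<theta> (P n) w"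
      by blast
    define u where "u = (\<lambda>w\<in>\<Omega>. \<theta> (P (to_nat_on \<Omega> w)) w)"
    have u: "u \<in> \<Omega> \<rightarrow>\<^sub>E \<Omega>"
      using P(1) \<theta>_in_\<Omega> Aut_rat_in_End_rat by (auto simp: u_def)
    have stable: "\<theta> (P n) w = u w" if w: "w \<in> \<Omega>" and "to_nat_on \<Omega> w \<le> n" for n w
      using that(2)
    proof (induction n rule: dec_induct)
      case base
      show ?case
        using w by (simp add: u_def)
    next
      case (step n)
      have "from_nat_into \<Omega> (to_nat_on \<Omega> w) = w"
        using countable w by simp
      then have "w \<in> W n"
        using step.hyps(1) by (auto simp: W_def intro!: image_eqI[of w _ "to_nat_on \<Omega> w"])
      then show ?case
        using P(4) step.IH by simp
    qed
    have "\<theta> g = u"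
    proof (rule closed_graph[OF u])
      fix V Q assume V: "finite V" "V \<subseteq> \<Omega>" and Q: "finite (Q :: rat set)"
      define n where "n = Max (insert 0 (to_nat_on \<Omega> ` V \<union> to_nat ` Q))"
      have n: "to_nat_on \<Omega> w \<le> n" if "w \<in> V" for w
        using that V Q by (simp add: n_def)
      have "to_nat q \<le> n" if "q \<in> Q" for q
        using that V Q by (simp add: n_def)
      then have "q \<in> F n" if "q \<in> Q" for q
        using that by (auto simp: F_def intro!: image_eqI[of q _ "to_nat q"])
      then show "\<exists>h\<in>End_rat. (\<forall>w\<in>V. \<theta> h w = u w) \<and> (\<forall>q\<in>Q. h q = g q)"
        using P(1)[of n] P(2)[of _ n] Aut_rat_in_End_rat stable V(2) n by (intro bexI[of _ "P n"]) auto
    qed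
    then show "\<theta> g x = x"
      using P(3) x by (simp add: u_def)
  qed
qed

text \<open>Automorphisms that agree on \<open>F w\<close> differ by an element of the stabilizer of \<open>w\<close>, so they move \<open>w\<close> to the
same point. An embedding \<open>f\<close> agrees on every finite set with some automorphism. The map \<open>u\<close> that sends
\<open>w\<close> to its image under any automorphism agreeing with \<open>f\<close> on \<open>F w\<close> is then approximated together with
\<open>f\<close>, whence \<open>u = \<theta> f\<close>.\<close>

lemma \<theta>_local_on_embeddings:
  assumes x: "x \<in> \<Omega>"
  obtains F where "finite F"
    "\<And>f g. strict_mono f \<Longrightarrow> strict_mono g \<Longrightarrow> \<forall>a\<in>F. f a = g a \<Longrightarrow> \<theta> f x = \<theta> g x"
proof -
  have "\<exists>F. finite F \<and> (\<forall>g\<in>Aut_rat. (\<forall>a\<in>F. g a = a) \<longrightarrow> \<theta> g w = w)" if "w \<in> \<Omega>" for w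
    by (rule stabilizer_open[OF that]) blast
  then obtain F where F: "\<And>w. w \<in> \<Omega> \<Longrightarrow> finite (F w)"
    "\<And>w g. w \<in> \<Omega> \<Longrightarrow> g \<in> Aut_rat \<Longrightarrow> \<forall>a\<in>F w. g a = a \<Longrightarrow> \<theta> g w = w"
    by metis
  have aut: "\<theta> h w = \<theta> k w"
    if w: "w \<in> \<Omega>" and hk: "h \<in> Aut_rat" "k \<in> Aut_rat" and eq: "\<forall>a\<in>F w. h a = k a" for h k w
  proof -
    let ?g = "inv_into UNIV h \<circ> k"
    have g: "?g \<in> Aut_rat"
      using hk by (intro comp_in_Aut_rat inv_in_Aut_rat)
    have "\<forall>a\<in>F w. ?g a = a"
      using eq bij_Aut_rat[OF hk(1)] by (simp add: bij_is_inj inv_f_eq)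
    then have "\<theta> ?g w = w"
      using F(2) w g by blast
    moreover have "h \<circ> ?g = k"
      using bij_Aut_rat[OF hk(1)] by (auto simp: fun_eq_iff bij_is_surj surj_f_inv_f)
    ultimately show ?thesis
      using \<theta>_comp[of h ?g w] hk(1) g w by (simp add: Aut_rat_in_End_rat)
  qed
  have ext: "\<exists>h\<in>Aut_rat. \<forall>a\<in>A. h a = f a" if "strict_mono f" "finite A" for f A
  proof -
    have "strict_mono_on A f"
      using that(1) by (simp add: strict_mono_on_def strict_mono_def)
    then show ?thesis
      using strict_mono_on_finite_extend[OF that(2)] by (auto simp: Aut_rat_def)
  qed
  have emb: "\<theta> f w = \<theta> h w"
    if f: "strict_mono f" and w: "w \<in> \<Omega>" and h: "h \<in> Aut_rat" "\<forall>a\<in>F w. h a = f a" for f h w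
  proof -
    have "\<forall>w. \<exists>h. w \<in> \<Omega> \<longrightarrow> h \<in> Aut_rat \<and> (\<forall>a\<in>F w. h a = f a)"
      using ext[OF f F(1)] by blast
    then obtain H where H: "\<And>w. w \<in> \<Omega> \<Longrightarrow> H w \<in> Aut_rat"
        "\<And>w. w \<in> \<Omega> \<Longrightarrow> \<forall>a\<in>F w. H w a = f a"
      by metis
    define u where "u = (\<lambda>w\<in>\<Omega>. \<theta> (H w) w)"
    have u: "u \<in> \<Omega> \<rightarrow>\<^sub>E \<Omega>"
      using H(1) \<theta>_in_\<Omega> Aut_rat_in_End_rat by (auto simp: u_def)
    have "\<theta> f = u"
    proof (rule closed_graph[OF u])
      fix V Q assume V: "finite V" "V \<subseteq> \<Omega>" and Q: "finite (Q :: rat set)"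
      have "finite (\<Union>(F ` V) \<union> Q)"
        using V F(1) Q by auto
      then obtain h where h: "h \<in> Aut_rat" "\<forall>a\<in>\<Union>(F ` V) \<union> Q. h a = f a"
        using ext[OF f] by blast
      have "\<theta> h w = u w" if "w \<in> V" for w
      proof -
        have w: "w \<in> \<Omega>"
          using that V(2) by blast
        have "\<theta> h w = \<theta> (H w) w"
          using h H[OF w] that by (intro aut w) auto
        then show ?thesis
          using w by (simp add: u_def)
      qed
      then show "\<exists>h\<in>End_rat. (\<forall>w\<in>V. \<theta> h w = u w) \<and> (\<forall>q\<in>Q. h q = f q)"
        using h Aut_rat_in_End_rat by blast
    qed
    then have "\<theta> f w = \<theta> (H w) w"
      using w by (simp add: u_def)
    also have "\<dots> = \<theta> h w"
      using H[OF w] h by (intro aut w) auto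
    finally show ?thesis .
  qed
  show thesis
  proof (rule that[OF F(1)[OF x]])
    fix f g :: "rat \<Rightarrow> rat" assume fg: "strict_mono f" "strict_mono g" "\<forall>a\<in>F x. f a = g a"
    obtain h where h: "h \<in> Aut_rat" "\<forall>a\<in>F x. h a = f a"
      using ext[OF fg(1) F(1)[OF x]] by blast
    then show "\<theta> f x = \<theta> g x"
      using emb[OF fg(1) x h] emb[OF fg(2) x h(1)] fg(3) by simp
  qed
qed

lemma \<theta>_local:
  assumes x: "x \<in> \<Omega>"
  obtains F where "finite F"
    "\<And>f g. f \<in> End_rat \<Longrightarrow> g \<in> End_rat \<Longrightarrow> \<forall>a\<in>F. f a = g a \<Longrightarrow> \<theta> f x = \<theta> g x"
proof -
  obtain p \<tau> where p: "p \<in> End_rat"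
    and \<tau>: "\<And>f. f \<in> End_rat \<Longrightarrow> strict_mono (\<lambda>x. \<tau> x (f x))"
      "\<And>f. f \<in> End_rat \<Longrightarrow> p \<circ> (\<lambda>x. \<tau> x (f x)) = f"
    by (rule End_rat_factor_through_embedding) blast
  obtain F where F: "finite F"
    "\<And>f g. strict_mono f \<Longrightarrow> strict_mono g \<Longrightarrow> \<forall>a\<in>F. f a = g a \<Longrightarrow> \<theta> f x = \<theta> g x"
    by (rule \<theta>_local_on_embeddings[OF x]) blast
  have factor: "\<theta> f x = \<theta> p (\<theta> (\<lambda>x. \<tau> x (f x)) x)" if "f \<in> End_rat" for f
    using \<theta>_comp[OF p strict_mono_in_End_rat[OF \<tau>(1)[OF that]] x] \<tau>(2)[OF that] by simp
  show thesis
  proof (rule that[OF F(1)])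
    fix f g assume fg: "f \<in> End_rat" "g \<in> End_rat" "\<forall>a\<in>F. f a = g a"
    have "\<theta> (\<lambda>x. \<tau> x (f x)) x = \<theta> (\<lambda>x. \<tau> x (g x)) x"
      using fg(3) by (intro F(2) \<tau>(1) fg(1,2)) simp
    then show "\<theta> f x = \<theta> g x"
      using factor fg(1,2) by simp
  qed
qed

lemma homeomorphic_map_\<theta>:
  "homeomorphic_map (subtopology (Tr_topology UNIV) End_rat) (subtopology (Tr_topology \<Omega>) E') \<theta>"
proof -
  let ?\<eta> = "inv_into End_rat \<theta>"
  have \<eta>: "?\<eta> e \<in> End_rat" "\<theta> (?\<eta> e) = e" if "e \<in> E'" for e
    using bij_betw_\<theta> that by (auto simp: bij_betw_def inv_into_into f_inv_into_f)
  have "continuous_map (subtopology (Tr_topology UNIV) End_rat) (subtopology (Tr_topology \<Omega>) E') \<theta>"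
  proof (rule continuous_map_subtopology_TrI)
    fix f x assume f: "f \<in> End_rat" and x: "x \<in> \<Omega>"
    show "\<exists>F. finite F \<and> F \<subseteq> UNIV \<and>
        (\<forall>g\<in>End_rat. (\<forall>a\<in>F. g a = f a) \<longrightarrow> \<theta> g x = \<theta> f x)"
      by (rule \<theta>_local[OF x]) (metis f subset_UNIV)
  qed (use E'_subset \<theta>_in_E' in auto)
  moreover have "continuous_map (subtopology (Tr_topology \<Omega>) E')
      (subtopology (Tr_topology UNIV) End_rat) ?\<eta>"
  proof (rule continuous_map_subtopology_TrI)
    fix e q assume e: "e \<in> E'"
    obtain w where w: "w \<in> \<Omega>"
      "\<And>f g. f \<in> End_rat \<Longrightarrow> g \<in> End_rat \<Longrightarrow> \<theta> f w = \<theta> g w \<Longrightarrow> f q = g q"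
      by (rule \<theta>_inverse_local[where q = q]) blast
    then show "\<exists>F. finite F \<and> F \<subseteq> \<Omega> \<and> (\<forall>d\<in>E'. (\<forall>a\<in>F. d a = e a) \<longrightarrow> ?\<eta> d q = ?\<eta> e q)"
      using \<eta> e by (intro exI[of _ "{w}"]) simp
  qed (use E'_subset \<eta> in auto)
  moreover have "?\<eta> (\<theta> f) = f" if "f \<in> End_rat" for f
    using bij_betw_\<theta> that by (simp add: bij_betw_def)
  ultimately have "homeomorphic_maps (subtopology (Tr_topology UNIV) End_rat)
      (subtopology (Tr_topology \<Omega>) E') \<theta> ?\<eta>"
    using \<eta>(2) by (simp add: homeomorphic_maps_def)
  then show ?thesis
    by (rule homeomorphic_maps_imp_map)
qed

end

theorem theorem4p4:
  fixes \<Omega> :: "'b set"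
    and E' :: "('b \<Rightarrow> 'b) set"
    and \<theta> :: "(rat \<Rightarrow> rat) \<Rightarrow> ('b \<Rightarrow> 'b)"
  assumes "countable \<Omega>"
    and "submonoid E' (Tr \<Omega>)"
    and "closedin (Tr_topology \<Omega>) E'"
    and "\<theta> \<in> iso ((Tr UNIV)\<lparr>carrier := End_rat\<rparr>) ((Tr \<Omega>)\<lparr>carrier := E'\<rparr>)"
  shows "homeomorphic_map (subtopology (Tr_topology UNIV) End_rat)
           (subtopology (Tr_topology \<Omega>) E') \<theta>"
proof -
  interpret closed_representation \<Omega> E' \<theta>
    by (rule closed_representation.intro[OF assms])
  show ?thesis
    by (rule homeomorphic_map_\<theta>)
qed

end
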